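(* Let $p \ge 1$ and let $\mathcal{K}$ be a finite multiplicative group of real orthogonal $p\times p$ matrices. Then the set $$\mathcal{F}(\mathcal{K}) = \{ \mathbf{Q} \in \mathcal{P}(p) \;:\; \mathbf{Q} = \mathbf{L}\mathbf{Q}\mathbf{L}^T \text{ for all } \mathbf{L} \in \mathcal{K} \}$$ is $g$-convex.
   Context: $\mathcal{P}(p)$ denotes the set (manifold) of real symmetric positive definite $p\times p$ matrices. For $\mathbf{Q}_0,\mathbf{Q}_1\in\mathcal{P}(p)$, the geodesic associated with them is $$\mathbf{Q}_t=\mathbf{Q}_0^{\frac12}\left(\mathbf{Q}_0^{-\frac12}\mathbf{Q}_1\mathbf{Q}_0^{-\frac12}\right)^t\mathbf{Q}_0^{\frac12},\qquad t\in[0,1],$$ where real powers of a symmetric positive definite matrix are the symmetric positive definite ones (defined by functional calculus on the eigenvalues). A set $\mathcal{N}\subset\mathcal{P}(p)$ is called $g$-convex if for any $\mathbf{Q}_0,\mathbf{Q}_1\in\mathcal{N}$ the geodesic lies in $\mathcal{N}$, i.e. $\mathbf{Q}_t\in\mathcal{N}$ for all $t\in[0,1]$. *)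

theory Defs
  imports "HOL-Analysis.Analysis" "HOL-Algebra.Group"
begin

definition spd_matrices :: "(real ^ 'n ^ 'n) set"
  where "spd_matrices = {A. transpose A = A \<and> (\<forall>x. x \<noteq> 0 \<longrightarrow> 0 < x \<bullet> (A *v x))}"

definition diag_matrix :: "('n \<Rightarrow> real) \<Rightarrow> real ^ 'n ^ 'n"
  where "diag_matrix d = (\<chi> i j. if i = j then d i else 0)"

(* Functional calculus for symmetric matrices. For symmetric A the matrix B exists by the
   spectral theorem and does not depend on the chosen diagonalisation; for non-symmetric A
   the value is unspecified. *)
definition matrix_fun :: "(real \<Rightarrow> real) \<Rightarrow> real ^ 'n ^ 'n \<Rightarrow> real ^ 'n ^ 'n"
  where "matrix_fun f A = (THE B. \<exists>U d. orthogonal_matrix U \<and>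
           A = U ** diag_matrix d ** transpose U \<and>
           B = U ** diag_matrix (\<lambda>i. f (d i)) ** transpose U)"

definition matrix_powr :: "real ^ 'n ^ 'n \<Rightarrow> real \<Rightarrow> real ^ 'n ^ 'n"
  where "matrix_powr A t = matrix_fun (\<lambda>x. x powr t) A"

definition spd_geodesic :: "real ^ 'n ^ 'n \<Rightarrow> real ^ 'n ^ 'n \<Rightarrow> real \<Rightarrow> real ^ 'n ^ 'n"
  where "spd_geodesic Q0 Q1 t =
           matrix_powr Q0 (1/2)
           ** matrix_powr (matrix_powr Q0 (- (1/2)) ** Q1 ** matrix_powr Q0 (- (1/2))) t
           ** matrix_powr Q0 (1/2)"

definition g_convex :: "(real ^ 'n ^ 'n) set \<Rightarrow> bool"
  where "g_convex N \<longleftrightarrow> N \<subseteq> spd_matrices \<and>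
           (\<forall>Q0\<in>N. \<forall>Q1\<in>N. \<forall>t\<in>{0..1}. spd_geodesic Q0 Q1 t \<in> N)"

definition invariant_spd :: "(real ^ 'n ^ 'n) set \<Rightarrow> (real ^ 'n ^ 'n) set"
  where "invariant_spd K = {Q \<in> spd_matrices. \<forall>L\<in>K. Q = L ** Q ** transpose L}"

end

(* A real matrix commutes with an orthogonal L exactly when it is invariant under conjugation by L,
   and f(A) commutes with everything that A commutes with: in eigenbases U, V of A the entries
   w of V^T L U satisfy e w = w d for eigenvalues d, e of A, hence w = 0 or e = d, and in both
   cases f(e) w = w f(d). So every factor of the geodesic commutes with K. *)

theory Submission
  imports Defs
begin

section \<open>Spectral theorem\<close>

text \<open>First-order optimality: \<open>c * (x \<bullet> x) - x \<bullet> f x\<close> is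
  nonnegative on \<open>S\<close> and vanishes at \<open>v\<close>, so its gradient along
  \<open>S\<close> vanishes there. Half of that gradient is \<open>c *\<^sub>R v - f v\<close>,
  which lies in \<open>S\<close> by invariance.\<close>

lemma quadratic_form_maximizer_eigenvector:
  fixes f :: "'a::euclidean_space \<Rightarrow> 'a"
  assumes lin: "linear f" and sa: "\<And>x y. x \<bullet> f y = f x \<bullet> y"
    and S: "subspace S" "\<And>x. x \<in> S \<Longrightarrow> f x \<in> S" and v: "v \<in> S"
    and max: "\<And>x. x \<in> S \<Longrightarrow> x \<bullet> f x \<le> c * (x \<bullet> x)" and eq: "v \<bullet> f v = c * (v \<bullet> v)"
  shows "f v = c *\<^sub>R v"
proof -
  define w where "w = c *\<^sub>R v - f v"
  have wS: "w \<in> S" unfolding w_def using S v by (simp add: subspace_diff subspace_scale)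
  define k where "k = c * (w \<bullet> w) - w \<bullet> f w"
  \<comment> \<open>This is the nonnegative form evaluated at \<open>v - s *\<^sub>R w\<close>, a
    step against the gradient. The constant term vanishes by \<open>eq\<close>, and self-adjointness
    merges the two mixed terms.\<close>
  have ineq: "0 \<le> - 2 * s * (w \<bullet> w) + s\<^sup>2 * k" for s
  proof -
    have "v - s *\<^sub>R w \<in> S" using S v wS by (simp add: subspace_diff subspace_scale)
    from max[OF this]
    have "0 \<le> c * ((v - s *\<^sub>R w) \<bullet> (v - s *\<^sub>R w)) - (v - s *\<^sub>R w) \<bullet> f (v - s *\<^sub>R w)" by simp
    also have "f (v - s *\<^sub>R w) = f v - s *\<^sub>R f w"
      using lin by (simp add: linear_diff linear_scale)
    also have "c * ((v - s *\<^sub>R w) \<bullet> (v - s *\<^sub>R w)) - (v - s *\<^sub>R w) \<bullet> (f v - s *\<^sub>R f w)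
        = - 2 * s * (c * (v \<bullet> w) - w \<bullet> f v) + s\<^sup>2 * k"
      using eq sa[of v w] unfolding k_def
      by (simp add: inner_diff_left inner_diff_right inner_commute algebra_simps power2_eq_square)
    also have "c * (v \<bullet> w) - w \<bullet> f v = w \<bullet> w"
      by (subst (3) w_def) (simp add: inner_diff_right inner_commute)
    finally show ?thesis .
  qed
  have "w \<bullet> w = 0"
  proof (rule ccontr)
    assume ne: "w \<bullet> w \<noteq> 0"
    then have pos: "w \<bullet> w > 0" using inner_ge_zero[of w] by linarith
    \<comment> \<open>The step is short enough that \<open>s\<^sup>2 * k\<close> is at most
      \<open>s * (w \<bullet> w)\<close>, which cannot offset the linear term
      \<open>- 2 * s * (w \<bullet> w)\<close>. Adding 1 keeps the denominator positive.\<close>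
    define s where "s = (w \<bullet> w) / (\<bar>k\<bar> + 1)"
    have s: "s > 0" and sk: "s * (\<bar>k\<bar> + 1) = w \<bullet> w" using pos by (simp_all add: s_def)
    have "s * k \<le> s * (\<bar>k\<bar> + 1)" using s by (intro mult_left_mono) auto
    then have "s * (s * k) \<le> s * (w \<bullet> w)" using s sk by (simp add: mult_left_mono)
    moreover have "s * (w \<bullet> w) > 0" using s pos by simp
    moreover have "s\<^sup>2 * k = s * (s * k)" by (simp add: power2_eq_square)
    ultimately show False using ineq[of s] by linarith
  qed
  then show ?thesis by (simp add: w_def)
qed

text \<open>The quadratic form attains a maximum on the compact unit sphere of \<open>S\<close>. By
  homogeneity the maximal value bounds the Rayleigh quotient on all of \<open>S\<close>, so the
  maximizer is an eigenvector.\<close>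

lemma selfadjoint_has_eigenvector:
  fixes f :: "'a::euclidean_space \<Rightarrow> 'a"
  assumes lin: "linear f" and sa: "\<And>x y. x \<bullet> f y = f x \<bullet> y"
    and S: "subspace S" "\<And>x. x \<in> S \<Longrightarrow> f x \<in> S" and ne: "S \<noteq> {0}"
  obtains v c where "v \<in> S" "norm v = 1" "f v = c *\<^sub>R v"
proof -
  obtain u where u: "u \<in> S" "u \<noteq> 0" using ne S subspace_0 by blast
  have "compact (S \<inter> sphere 0 1)"
    using closed_subspace[OF S(1)] by (intro closed_Int_compact) auto
  moreover have "(1 / norm u) *\<^sub>R u \<in> S \<inter> sphere 0 1"
    using u S by (simp add: subspace_scale)
  moreover have "continuous_on (S \<inter> sphere 0 1) (\<lambda>x. x \<bullet> f x)"
    using lin by (intro continuous_intros linear_continuous_on) (simp add: linear_conv_bounded_linear)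
  ultimately obtain v where v: "v \<in> S \<inter> sphere 0 1"
    and vmax: "\<And>x. x \<in> S \<inter> sphere 0 1 \<Longrightarrow> x \<bullet> f x \<le> v \<bullet> f v"
    using continuous_attains_sup[of "S \<inter> sphere 0 1" "\<lambda>x. x \<bullet> f x"] by blast
  have nv: "norm v = 1" using v by simp
  have "x \<bullet> f x \<le> (v \<bullet> f v) * (x \<bullet> x)" if "x \<in> S" for x
  proof (cases "x = 0")
    case False
    have "(1 / norm x) *\<^sub>R x \<in> S \<inter> sphere 0 1" using that False S by (simp add: subspace_scale)
    from vmax[OF this] have "(x \<bullet> f x) / (norm x * norm x) \<le> v \<bullet> f v"
      using lin by (simp add: linear_scale)
    then show ?thesis using False
      by (simp add: divide_le_eq dot_square_norm power2_eq_square)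
  qed simp
  then have "f v = (v \<bullet> f v) *\<^sub>R v"
    using v nv by (intro quadratic_form_maximizer_eigenvector[OF lin sa S]) (auto simp: dot_square_norm)
  with v nv that show ?thesis by blast
qed

text \<open>Induction on the dimension of the invariant subspace: split off one unit eigenvector
  \<open>v\<close> and continue in its orthogonal complement \<open>T\<close> within
  \<open>S\<close>. Self-adjointness keeps \<open>T\<close> invariant, since
  \<open>v \<bullet> f x = f v \<bullet> x\<close> is a multiple of
  \<open>v \<bullet> x\<close>.\<close>

lemma selfadjoint_orthonormal_eigenbasis:
  fixes f :: "'a::euclidean_space \<Rightarrow> 'a"
  assumes lin: "linear f" and sa: "\<And>x y. x \<bullet> f y = f x \<bullet> y"
    and "subspace S" "\<And>x. x \<in> S \<Longrightarrow> f x \<in> S"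
  shows "\<exists>B \<subseteq> S. pairwise orthogonal B \<and> (\<forall>v\<in>B. norm v = 1 \<and> (\<exists>c. f v = c *\<^sub>R v)) \<and> S \<subseteq> span B"
  using assms(3-)
proof (induction "dim S" arbitrary: S rule: less_induct)
  case less
  show ?case
  proof (cases "S = {0}")
    case True
    then show ?thesis by (intro exI[of _ "{}"]) auto
  next
    case False
    from selfadjoint_has_eigenvector[OF lin sa less.prems False]
    obtain v c where v: "v \<in> S" "norm v = 1" "f v = c *\<^sub>R v" by blast
    define T where "T = S \<inter> {x. v \<bullet> x = 0}"
    have sT: "subspace T" unfolding T_def
      by (intro subspace_inter less.prems subspace_hyperplane)
    have invT: "f x \<in> T" if "x \<in> T" for x
      using that less.prems(2) v(3) sa[of v x] by (simp add: T_def)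
    have "v \<notin> T" using v(2) by (simp add: T_def dot_square_norm)
    moreover have "T \<subseteq> S" by (auto simp: T_def)
    ultimately have "T \<subset> S" using v(1) by blast
    then have "dim T < dim S"
      using sT less.prems(1) by (intro dim_psubset) (simp add: span_eq_iff[THEN iffD2])
    from less.hyps[OF this sT invT] obtain B where B: "B \<subseteq> T" "pairwise orthogonal B"
      "\<forall>v\<in>B. norm v = 1 \<and> (\<exists>c. f v = c *\<^sub>R v)" "T \<subseteq> span B" by blast
    have "pairwise orthogonal (insert v B)"
      using B(1,2) by (auto simp: pairwise_insert T_def orthogonal_def inner_commute)
    moreover have "S \<subseteq> span (insert v B)"
    proof
      fix x assume x: "x \<in> S"
      \<comment> \<open>Removing the orthogonal projection onto the unit vector \<open>v\<close>
        leaves a vector orthogonal to \<open>v\<close>.\<close>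
      have "x - (v \<bullet> x) *\<^sub>R v \<in> T"
        using x v less.prems(1)
        by (simp add: T_def subspace_diff subspace_scale inner_diff_right dot_square_norm)
      then have "x - (v \<bullet> x) *\<^sub>R v \<in> span B" using B(4) by blast
      then show "x \<in> span (insert v B)" by (auto simp: span_insert)
    qed
    ultimately show ?thesis
      using B v by (intro exI[of _ "insert v B"]) (auto simp: T_def)
  qed
qed

section \<open>Diagonalization of symmetric matrices\<close>

lemma matrix_mul_diag_matrix: "(A ** diag_matrix d) $ i $ j = A $ i $ j * d j"
  by (simp add: matrix_matrix_mult_def diag_matrix_def if_distrib[of "(*) _"] cong: if_cong)

lemma diag_matrix_mul_matrix: "(diag_matrix d ** A) $ i $ j = d i * A $ i $ j"
  by (simp add: matrix_matrix_mult_def diag_matrix_def if_distrib[of "\<lambda>x. x * _"] cong: if_cong)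

lemma symmetric_matrix_diagonalizable:
  fixes A :: "real ^ 'n ^ 'n"
  assumes "transpose A = A"
  obtains U d where "orthogonal_matrix U" "A = U ** diag_matrix d ** transpose U"
proof -
  have "\<And>x y. x \<bullet> (A *v y) = (A *v x) \<bullet> y"
    using assms by (metis dot_lmul_matrix vector_transpose_matrix)
  from selfadjoint_orthonormal_eigenbasis[OF matrix_vector_mul_linear this subspace_UNIV]
  obtain B where B: "pairwise orthogonal B" "\<forall>v\<in>B. norm v = 1 \<and> (\<exists>c. A *v v = c *\<^sub>R v)"
    and sp: "span B = (UNIV :: (real^'n) set)" by blast
  have "0 \<notin> B" using B(2) by auto
  then have ind: "independent B" using B(1) pairwise_orthogonal_independent by blast
  \<comment> \<open>The cardinality match lets the index type \<open>'n\<close> itself enumerate the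
    eigenbasis, whose vectors become the columns of \<open>U\<close>.\<close>
  have "card B = CARD('n)"
    using dim_eq_card[OF _ ind, of UNIV] sp by simp
  moreover have "finite B" using ind by (rule independent_imp_finite)
  ultimately obtain h where h: "bij_betw h (UNIV :: 'n set) B"
    using finite_same_card_bij[of "UNIV :: 'n set" B] by auto
  have hB: "h j \<in> B" for j using h by (auto simp: bij_betw_def)
  have "\<forall>j. \<exists>c. A *v h j = c *\<^sub>R h j" using B(2) hB by blast
  then have "\<exists>d. \<forall>j. A *v h j = d j *\<^sub>R h j" by (rule choice)
  then obtain d where d: "\<And>j. A *v h j = d j *\<^sub>R h j" by blast
  define U where "U = (\<chi> i j. h j $ i)"
  have "h i \<bullet> h j = (if i = j then 1 else 0)" for i j
    using B hB h unfolding pairwise_def orthogonal_def bij_betw_def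
    by (auto simp: dot_square_norm inj_eq)
  then have "transpose U ** U = mat 1"
    by (simp add: vec_eq_iff U_def matrix_matrix_mult_def transpose_def mat_def inner_vec_def)
  then have orth: "orthogonal_matrix U" by (simp add: orthogonal_matrix)
  have "A ** U = U ** diag_matrix d"
  proof -
    have "(A ** U) $ i $ j = (A *v h j) $ i" for i j
      by (simp add: matrix_matrix_mult_def matrix_vector_mult_def U_def)
    then show ?thesis
      unfolding vec_eq_iff matrix_mul_diag_matrix by (simp add: d U_def mult.commute)
  qed
  then have "A = U ** diag_matrix d ** transpose U"
    using orth by (metis matrix_mul_assoc matrix_mul_rid orthogonal_matrix_def)
  with orth that show ?thesis by blast
qed

section \<open>Functional calculus\<close>

lemma orthogonal_matrix_cancel:
  assumes "orthogonal_matrix U"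
  shows "transpose U ** (U ** X) = X" "U ** (transpose U ** X) = X"
    "X ** U ** transpose U = X" "X ** transpose U ** U = X"
  using assms
  by (metis matrix_mul_assoc matrix_mul_lid orthogonal_matrix_def,
      metis matrix_mul_assoc matrix_mul_lid orthogonal_matrix_def,
      metis matrix_mul_assoc matrix_mul_rid orthogonal_matrix_def,
      metis matrix_mul_assoc matrix_mul_rid orthogonal_matrix_def)

text \<open>Two diagonalizations are allowed so that one statement serves twice:
  \<open>L = mat 1\<close> shows that the functional calculus is independent of the diagonalization,
  and \<open>V = U\<close> with \<open>e = d\<close> gives commutation.\<close>

lemma diagonalized_intertwine:
  fixes L :: "real ^ 'n ^ 'n"
  assumes U: "orthogonal_matrix U" and V: "orthogonal_matrix V"
    and L: "L ** (U ** diag_matrix d ** transpose U) = (V ** diag_matrix e ** transpose V) ** L"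
  shows "L ** (U ** diag_matrix (\<lambda>i. f (d i)) ** transpose U)
       = (V ** diag_matrix (\<lambda>i. f (e i)) ** transpose V) ** L"
proof -
  \<comment> \<open>\<open>W\<close> expresses \<open>L\<close> from the basis \<open>U\<close> to
    the basis \<open>V\<close>. In these coordinates the hypothesis becomes
    \<open>W ** diag_matrix d = diag_matrix e ** W\<close>, which can be read entry by
    entry.\<close>
  define W where "W = transpose V ** L ** U"
  have LW: "L = V ** W ** transpose U"
    unfolding W_def using U V by (simp add: orthogonal_matrix_cancel flip: matrix_mul_assoc)
      (metis U matrix_mul_rid orthogonal_matrix_def)
  have "W ** diag_matrix d
      = transpose V ** (L ** (U ** diag_matrix d ** transpose U)) ** U"
    unfolding W_def by (simp add: matrix_mul_assoc orthogonal_matrix_cancel[OF U])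
  also have "\<dots> = diag_matrix e ** W"
    unfolding L W_def
    by (simp add: orthogonal_matrix_cancel[OF V] flip: matrix_mul_assoc)
  finally have "W $ i $ j * d j = e i * W $ i $ j" for i j
    by (metis diag_matrix_mul_matrix matrix_mul_diag_matrix)
  then have "W $ i $ j * f (d j) = f (e i) * W $ i $ j" for i j
    by (metis mult.commute mult_cancel_right)
  then have "W ** diag_matrix (\<lambda>i. f (d i)) = diag_matrix (\<lambda>i. f (e i)) ** W"
    unfolding vec_eq_iff matrix_mul_diag_matrix diag_matrix_mul_matrix by blast
  then have "V ** (W ** diag_matrix (\<lambda>i. f (d i))) ** transpose U
      = V ** (diag_matrix (\<lambda>i. f (e i)) ** W) ** transpose U" by simp
  then show ?thesis
    unfolding LW using U V
    by (simp add: orthogonal_matrix_cancel flip: matrix_mul_assoc)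
qed

lemma matrix_fun_diagonalized:
  assumes U: "orthogonal_matrix U" and A: "A = U ** diag_matrix d ** transpose U"
  shows "matrix_fun f A = U ** diag_matrix (\<lambda>i. f (d i)) ** transpose U"
  unfolding matrix_fun_def
proof (rule the_equality)
  fix B assume "\<exists>V e. orthogonal_matrix V \<and> A = V ** diag_matrix e ** transpose V \<and>
      B = V ** diag_matrix (\<lambda>i. f (e i)) ** transpose V"
  then obtain V e where V: "orthogonal_matrix V" "A = V ** diag_matrix e ** transpose V"
    "B = V ** diag_matrix (\<lambda>i. f (e i)) ** transpose V" by blast
  show "B = U ** diag_matrix (\<lambda>i. f (d i)) ** transpose U"
    using diagonalized_intertwine[OF U V(1), of "mat 1" d e f] A V(2,3)
    by (metis matrix_mul_lid matrix_mul_rid)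
qed (use assms in blast)

lemma matrix_fun_commute:
  fixes A :: "real ^ 'n ^ 'n"
  assumes "transpose A = A" "L ** A = A ** L"
  shows "L ** matrix_fun f A = matrix_fun f A ** L"
proof -
  obtain U d where U: "orthogonal_matrix U" "A = U ** diag_matrix d ** transpose U"
    using assms(1) by (rule symmetric_matrix_diagonalizable)
  show ?thesis
    using diagonalized_intertwine[OF U(1) U(1), of L d d f] assms(2) U(2)
    by (metis matrix_fun_diagonalized[OF U])
qed

section \<open>Positive definite matrices\<close>

lemma inner_congruence:
  fixes A :: "real ^ 'n ^ 'n"
  shows "x \<bullet> ((P ** A ** transpose P) *v x) = (x v* P) \<bullet> (A *v (x v* P))"
proof -
  have "(P ** A ** transpose P) *v x = P *v (A *v (x v* P))"
    by (simp flip: matrix_vector_mul_assoc)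
  then show ?thesis by (simp add: dot_lmul_matrix)
qed

text \<open>The form of the product at \<open>x\<close> is the form of \<open>A\<close> at
  \<open>x v* P\<close>, so positivity survives as soon as this substitution sends nonzero vectors
  to nonzero vectors.\<close>

lemma spd_congruence:
  fixes A :: "real ^ 'n ^ 'n"
  assumes A: "A \<in> spd_matrices" and P: "\<And>x. x \<noteq> 0 \<Longrightarrow> x v* P \<noteq> 0"
  shows "P ** A ** transpose P \<in> spd_matrices"
  using assms
  by (auto simp: spd_matrices_def inner_congruence matrix_transpose_mul matrix_mul_assoc)

lemma orthogonal_matrix_mult_nonzero:
  fixes U :: "real ^ 'n ^ 'n"
  assumes "orthogonal_matrix U" "x \<noteq> 0"
  shows "U *v x \<noteq> 0" "x v* U \<noteq> 0"
  using assms unfolding transpose_matrix_vector[symmetric]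
  by (metis matrix_vector_mul_assoc matrix_vector_mul_lid matrix_vector_mult_0_right
      orthogonal_matrix_def)+

lemma diag_matrix_spd_iff: "diag_matrix d \<in> spd_matrices \<longleftrightarrow> (\<forall>i. 0 < d i)"
proof -
  have form: "x \<bullet> (diag_matrix d *v x) = (\<Sum>i\<in>UNIV. d i * (x $ i)\<^sup>2)" for x
    by (simp add: inner_vec_def matrix_vector_mult_def diag_matrix_def power2_eq_square
        if_distrib[of "\<lambda>x. x * _"] cong: if_cong) (simp add: mult_ac)
  have symm: "transpose (diag_matrix d) = diag_matrix d"
    by (simp add: vec_eq_iff transpose_def diag_matrix_def)
  show ?thesis
  proof
    assume *: "diag_matrix d \<in> spd_matrices"
    show "\<forall>i. 0 < d i"
    proof
      fix i
      \<comment> \<open>The \<open>i\<close>-th unit vector isolates the single term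
        \<open>d i\<close> of the sum in \<open>form\<close>.\<close>
      have "0 < axis i 1 \<bullet> (diag_matrix d *v axis i 1)"
        using * by (simp add: spd_matrices_def axis_eq_0_iff)
      then show "0 < d i"
        unfolding form by (simp add: axis_def if_distrib[of "\<lambda>x. x\<^sup>2"] if_distrib[of "(*) _"] cong: if_cong)
    qed
  next
    assume d: "\<forall>i. 0 < d i"
    have "0 < (\<Sum>i\<in>UNIV. d i * (x $ i)\<^sup>2)" if nz: "x \<noteq> 0" for x
    proof -
      obtain k where "x $ k \<noteq> 0" using nz by (auto simp: vec_eq_iff)
      then show ?thesis using d by (intro sum_pos2[of _ k]) (auto simp: less_imp_le)
    qed
    with symm form show "diag_matrix d \<in> spd_matrices" by (simp add: spd_matrices_def)
  qed
qed

text \<open>Congruence by \<open>transpose U\<close> exposes the eigenvalues as positive diagonal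
  entries; their powers are positive, and congruence by \<open>U\<close> carries them back.\<close>

lemma matrix_powr_spd:
  assumes A: "A \<in> spd_matrices"
  shows "matrix_powr A t \<in> spd_matrices"
proof -
  have "transpose A = A" using A by (simp add: spd_matrices_def)
  then obtain U d where U: "orthogonal_matrix U" "A = U ** diag_matrix d ** transpose U"
    by (rule symmetric_matrix_diagonalizable)
  have "transpose U ** A ** transpose (transpose U) \<in> spd_matrices"
    using A U(1) by (intro spd_congruence) (simp_all add: orthogonal_matrix_mult_nonzero)
  moreover have "transpose U ** A ** transpose (transpose U) = diag_matrix d"
    unfolding U(2) using U(1) by (metis orthogonal_matrix_cancel(1,4) matrix_mul_assoc transpose_transpose)
  ultimately have "\<forall>i. 0 < d i" by (simp add: diag_matrix_spd_iff)
  \<comment> \<open>\<open>powr\<close> is 0 at base 0 and positive at any nonzero base, hence the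
    passage from \<open>0 < d i\<close> to an inequation.\<close>
  then have "diag_matrix (\<lambda>i. d i powr t) \<in> spd_matrices"
    by (auto simp: diag_matrix_spd_iff less_imp_neq[symmetric])
  then show ?thesis
    unfolding matrix_powr_def matrix_fun_diagonalized[OF U]
    using U(1) by (intro spd_congruence) (simp_all add: orthogonal_matrix_mult_nonzero)
qed

text \<open>By symmetry of \<open>P\<close> this is a congruence, and \<open>P\<close> has trivial
  kernel because \<open>x \<bullet> (P *v x)\<close> is positive for nonzero
  \<open>x\<close>.\<close>

lemma spd_sandwich:
  assumes "P \<in> spd_matrices" "A \<in> spd_matrices"
  shows "P ** A ** P \<in> spd_matrices"
proof -
  have P: "transpose P = P" using assms by (simp add: spd_matrices_def)
  have "x v* P \<noteq> 0" if "x \<noteq> 0" for x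
    using assms(1) that unfolding transpose_matrix_vector[symmetric] P
    by (metis (mono_tags, lifting) inner_zero_right less_irrefl mem_Collect_eq spd_matrices_def)
  from spd_congruence[OF assms(2) this] show ?thesis unfolding P .
qed

section \<open>Commutation along the geodesic\<close>

lemma matrix_powr_commute:
  assumes "A \<in> spd_matrices" "L ** A = A ** L"
  shows "L ** matrix_powr A t = matrix_powr A t ** L"
  using assms unfolding matrix_powr_def by (intro matrix_fun_commute) (simp_all add: spd_matrices_def)

lemma commute_sandwich:
  fixes L :: "real ^ 'n ^ 'n"
  assumes "L ** P = P ** L" "L ** A = A ** L"
  shows "L ** (P ** A ** P) = (P ** A ** P) ** L"
  using assms by (metis matrix_mul_assoc)

lemma spd_geodesic_spd:
  assumes "Q0 \<in> spd_matrices" "Q1 \<in> spd_matrices"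
  shows "spd_geodesic Q0 Q1 t \<in> spd_matrices"
  using assms unfolding spd_geodesic_def by (intro spd_sandwich matrix_powr_spd)

text \<open>Commutation passes from \<open>Q0\<close> and \<open>Q1\<close> outward through the
  nested powers and sandwiches. Definiteness is carried along because the inner sandwich must be
  symmetric before its power is known to commute with \<open>L\<close>.\<close>

lemma spd_geodesic_commute:
  assumes "Q0 \<in> spd_matrices" "Q1 \<in> spd_matrices" "L ** Q0 = Q0 ** L" "L ** Q1 = Q1 ** L"
  shows "L ** spd_geodesic Q0 Q1 t = spd_geodesic Q0 Q1 t ** L"
  using assms unfolding spd_geodesic_def
  by (intro commute_sandwich matrix_powr_commute spd_sandwich matrix_powr_spd)

text \<open>Multiply on the right by \<open>L\<close> or by its transpose. Commutation is the form
  of invariance that passes through products and functional calculus.\<close>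

lemma orthogonal_conjugation_fixed_iff:
  assumes "orthogonal_matrix L"
  shows "Q = L ** Q ** transpose L \<longleftrightarrow> L ** Q = Q ** L"
  using orthogonal_matrix_cancel(3,4)[OF assms] by metis

theorem theorem1:
  fixes K :: "(real ^ 'n ^ 'n) set"
  assumes "finite K"
    and "\<forall>L\<in>K. orthogonal_matrix L"
    and "group \<lparr>carrier = K, monoid.mult = (**), one = mat 1\<rparr>"
  shows "g_convex (invariant_spd K)"
proof -
  have "invariant_spd K = {Q \<in> spd_matrices. \<forall>L\<in>K. L ** Q = Q ** L}"
    using assms(2) orthogonal_conjugation_fixed_iff unfolding invariant_spd_def by blast
  then show ?thesis
    unfolding g_convex_def by (simp add: spd_geodesic_spd spd_geodesic_commute)
qed

end
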